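(* For any positive integers $\alpha,m,n,r$, we have $$\frac{(2,n)}{n(n+1)(n+2)}\sum_{k=1}^{n}k^r(k+1)^r(2k+1)\,w_{k}^{(\alpha)}(x)^{m}\in\mathbb{Z}[x]$$ and $$\frac{(2,n)}{n(n+1)(n+2)}\sum_{k=1}^{n}(-1)^{k}k^r(k+1)^r(2k+1)\,w_{k}^{(\alpha)}(x)^{m}\in\mathbb{Z}[x].$$
   Context: $(2,n)$ denotes the greatest common divisor of $2$ and $n$. For positive integers $k,\alpha$, $$w_k^{(\alpha)}(x)=\sum_{j=1}^{k}w(k,j)^{\alpha}x^{j-1},\qquad w(k,j)=\frac1j\binom{k-1}{j-1}\binom{k+j}{j-1}=\binom{k-1}{j-1}\binom{k+j}{j}-\binom{k}{j}\binom{k+j}{j-1}\in\mathbb{Z}.$$ *)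

theory Defs
  imports Complex_Main "HOL-Computational_Algebra.Polynomial"
begin

definition w :: "nat \<Rightarrow> nat \<Rightarrow> rat" where
  "w k j = 1 / of_nat j * of_nat ((k - 1) choose (j - 1)) * of_nat ((k + j) choose (j - 1))"

lemma w_eq_diff:
  assumes "k \<ge> 1" "j \<ge> 1"
  shows "w k j = of_nat ((k - 1) choose (j - 1)) * of_nat ((k + j) choose j)
                 - of_nat (k choose j) * of_nat ((k + j) choose (j - 1))"
proof -
  obtain a b where ab: "k = Suc a" "j = Suc b"
    using assms by (metis Suc_le_D One_nat_def)
  have "Suc b * (Suc a choose Suc b) = Suc a * (a choose b)"
    by (rule Suc_times_binomial)
  hence 1: "of_nat (Suc b) * of_nat (Suc a choose Suc b) = (of_nat (Suc a) * of_nat (a choose b) :: rat)"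
    by (metis of_nat_mult)
  have "Suc b * ((Suc a + Suc b) choose Suc b) = (a + 2) * ((Suc a + Suc b) choose b)"
    using binomial_absorb_comp[of "Suc a + Suc b" b] binomial_absorption[of b "Suc a + Suc b"]
    by simp
  hence 2: "of_nat (Suc b) * of_nat ((Suc a + Suc b) choose Suc b)
            = (of_nat (a + 2) * of_nat ((Suc a + Suc b) choose b) :: rat)"
    by (metis of_nat_mult)
  have nz: "(of_nat (Suc b) :: rat) \<noteq> 0"
    by (simp only: of_nat_eq_0_iff)
  have e1: "of_nat (Suc a choose Suc b) = (of_nat (Suc a) * of_nat (a choose b) / of_nat (Suc b) :: rat)"
    using 1 nz by (metis nonzero_mult_div_cancel_left)
  have e2: "of_nat ((Suc a + Suc b) choose Suc b)
            = (of_nat (a + 2) * of_nat ((Suc a + Suc b) choose b) / of_nat (Suc b) :: rat)"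
    using 2 nz by (metis nonzero_mult_div_cancel_left)
  show ?thesis
    unfolding w_def ab e1 e2 diff_Suc_1 using nz by (simp add: divide_simps) (simp add: algebra_simps)
qed

lemma w_in_Ints:
  assumes "k \<ge> 1" "j \<ge> 1"
  shows "w k j \<in> \<int>"
  unfolding w_eq_diff[OF assms] by (intro Ints_diff Ints_mult Ints_of_nat)

definition w_poly :: "nat \<Rightarrow> nat \<Rightarrow> rat poly" where
  "w_poly \<alpha> k = (\<Sum>j = 1..k. monom (w k j ^ \<alpha>) (j - 1))"

text \<open>The subring \<open>\<int>[x]\<close> of \<open>\<rat>[x]\<close>.\<close>

definition int_polys :: "rat poly set" where
  "int_polys = {p. \<forall>i. coeff p i \<in> \<int>}"

end

theory Submission
  imports Defs
begin

text \<open>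
  Put \<open>X = k (k + 1)\<close>. As a polynomial in \<open>X\<close>, \<open>w k j\<close> is
  \<open>(\<Prod>i = 2..j. X - i (i - 1)) / (j! (j - 1)!)\<close>, so \<open>X w\<^sub>j = j (j + 1) (w\<^sub>j\<^sub>+\<^sub>1 + w\<^sub>j)\<close>.
  Products \<open>w\<^sub>i w\<^sub>j\<close> are combinations of the \<open>w\<^sub>s\<close> with explicit coefficients, which turn out to be
  natural numbers. Hence every coefficient of \<open>X\<^sup>r\<^sup>-\<^sup>1 w_poly\<^sup>m\<close> is a natural combination
  of the \<open>w\<^sub>s\<close>, and it remains to treat the sums of \<open>\<plusminus> X (2 k + 1) w\<^sub>s\<close>, which telescope to
  products of binomial coefficients.
\<close>

section \<open>Absorption identities for binomials, cast into a ring so that \<open>n - k\<close> is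
  not truncated\<close>

lemma of_nat_binomial_Suc:
  "of_nat (Suc k) * of_nat (n choose Suc k)
    = (of_nat n - of_nat k) * (of_nat (n choose k) :: 'a::comm_ring_1)"
proof (cases "k \<le> n")
  case True
  have "Suc k * (n choose Suc k) = (n - k) * (n choose k)"
    by (metis binomial_absorption binomial_absorb_comp)
  then have "of_nat (Suc k * (n choose Suc k)) = (of_nat ((n - k) * (n choose k)) :: 'a)"
    by simp
  then show ?thesis using True by (simp only: of_nat_mult of_nat_diff)
qed (simp add: binomial_eq_0)

lemma of_nat_Suc_binomial_Suc:
  "of_nat (Suc k) * of_nat (Suc n choose Suc k)
    = of_nat (Suc n) * (of_nat (n choose k) :: 'a::comm_ring_1)"
  by (metis Suc_times_binomial of_nat_mult)

lemma of_nat_Suc_binomial: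
  "(of_nat (Suc n) - of_nat k) * of_nat (Suc n choose k)
    = of_nat (Suc n) * (of_nat (n choose k) :: 'a::comm_ring_1)"
  by (metis of_nat_binomial_Suc of_nat_Suc_binomial_Suc)


section \<open>The recurrence in the second index\<close>

lemma w_Suc_Suc:
  "w (Suc k) (Suc j) = of_nat (k choose j) * of_nat ((k + j + 2) choose j) / of_nat (Suc j)"
  by (simp add: w_def)

text \<open>Consecutive values have ratio
  \<open>(K - J) * (K + J + 3) / ((J + 1) * (J + 2))\<close>, and
  \<open>(K - J) * (K + J + 3)\<close> equals
  \<open>(K + 1) * (K + 2) - (J + 1) * (J + 2)\<close>.\<close>

lemma w_recurrence:
  "of_nat ((j + 1) * (j + 2)) * (w (Suc k) (Suc (Suc j)) + w (Suc k) (Suc j))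
    = of_nat ((k + 1) * (k + 2)) * w (Suc k) (Suc j)"
proof -
  define a where "a = (of_nat (k choose j) :: rat)"
  define a' where "a' = (of_nat (k choose Suc j) :: rat)"
  define b where "b = (of_nat ((k + j + 2) choose j) :: rat)"
  define b' where "b' = (of_nat ((k + j + 3) choose Suc j) :: rat)"
  define K where "K = (of_nat k :: rat)"
  define J where "J = (of_nat j :: rat)"
  have J: "J + 1 \<noteq> 0" "J + 2 \<noteq> 0"
    unfolding J_def by linarith+
  have 1: "(J + 1) * a' = (K - J) * a"
    using of_nat_binomial_Suc[of j k, where 'a=rat]
    by (simp add: a_def a'_def K_def J_def add.commute)
  have 2: "(J + 1) * b' = (K + J + 3) * b"
    using of_nat_Suc_binomial_Suc[of j "k + j + 2", where 'a=rat]
    by (simp add: b_def b'_def K_def J_def add_ac numeral_3_eq_3)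
  have w1: "w (Suc k) (Suc j) = a * b / (J + 1)"
    by (simp add: w_Suc_Suc a_def b_def J_def add.commute)
  have w2: "w (Suc k) (Suc (Suc j)) = a' * b' / (J + 2)"
    by (simp add: w_Suc_Suc a'_def b'_def J_def add.commute numeral_3_eq_3)
  have "(J + 1) * ((J + 1) * (a' * b')) = ((K - J) * a) * ((K + J + 3) * b)"
    using 1 2 by algebra
  then have "(J + 1) * (a' * b') = (K - J) * (K + J + 3) * (a * b / (J + 1))"
    using J by (simp add: field_simps)
  then have "(J + 1) * (J + 2) * (a' * b' / (J + 2)) = (K - J) * (K + J + 3) * (a * b / (J + 1))"
    using J by simp
  moreover have "of_nat ((j + 1) * (j + 2)) = (J + 1) * (J + 2)"
    "of_nat ((k + 1) * (k + 2)) = (K + 1) * (K + 2)"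
    by (simp_all add: J_def K_def algebra_simps)
  ultimately show ?thesis
    unfolding w1 w2 by algebra
qed


section \<open>Linearization of products\<close>

text \<open>Numerator of the coefficient of \<open>w (Suc k) (Suc (m + l))\<close> in the product of
  \<open>w (Suc k) (Suc m)\<close> and \<open>w (Suc k) (Suc n)\<close>. It is kept as a natural
  number so that its divisibility by \<open>m + l + 2\<close> can be proved separately.\<close>

definition lin_num :: "nat \<Rightarrow> nat \<Rightarrow> nat \<Rightarrow> nat" where
  "lin_num m n l = ((m + n + 2) choose (n + 1)) * ((m + l) choose n) * (n choose l)"

definition lin_coeff :: "nat \<Rightarrow> nat \<Rightarrow> nat \<Rightarrow> rat" where
  "lin_coeff m n l = of_nat (lin_num m n l) / of_nat (m + l + 2)"

text \<open>Serves the induction on \<open>m\<close> in \<open>dvd_lin_num\<close>: the right side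
  shows a factor \<open>m + l + 3\<close>, which is coprime to the factor \<open>m + l + 2\<close>
  on the left.\<close>

lemma lin_num_step:
  "(m + l + 2) * (lin_num (Suc m) n l + lin_num m n (Suc l))
    = (m + l + 3) * (((m + n + 2) choose n) * ((m + l + 2) choose (n + 1)) * ((n + 1) choose (l + 1)))"
proof -
  define M N L where "M = (of_nat m :: rat)" and "N = (of_nat n :: rat)" and "L = (of_nat l :: rat)"
  define q where "q = (of_nat ((m + n + 2) choose (n + 1)) :: rat)"
  define q' where "q' = (of_nat ((m + n + 3) choose (n + 1)) :: rat)"
  define q0 where "q0 = (of_nat ((m + n + 2) choose n) :: rat)"
  define b where "b = (of_nat ((m + l + 1) choose n) :: rat)"
  define b' where "b' = (of_nat ((m + l + 2) choose (n + 1)) :: rat)"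
  define c where "c = (of_nat (n choose l) :: rat)"
  define c1 where "c1 = (of_nat (n choose (l + 1)) :: rat)"
  define c' where "c' = (of_nat ((n + 1) choose (l + 1)) :: rat)"
  have nz: "M + 2 \<noteq> 0" "N + 1 \<noteq> 0" "L + 1 \<noteq> 0"
    unfolding M_def N_def L_def by linarith+
  have 1: "(M + 2) * q' = (M + N + 3) * q"
    using of_nat_Suc_binomial[of "m + n + 2" "n + 1", where 'a=rat]
    by (simp add: q_def q'_def M_def N_def add_ac numeral_3_eq_3)
  have 2: "(N + 1) * q = (M + 2) * q0"
    using of_nat_binomial_Suc[of n "m + n + 2", where 'a=rat]
    by (simp add: q_def q0_def M_def N_def add_ac)
  have 3: "(N + 1) * b' = (M + L + 2) * b"
    using of_nat_Suc_binomial_Suc[of n "m + l + 1", where 'a=rat]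
    by (simp add: b_def b'_def M_def N_def L_def add_ac)
  have 4: "(L + 1) * c1 = (N - L) * c"
    using of_nat_binomial_Suc[of l n, where 'a=rat]
    by (simp add: c_def c1_def N_def L_def add_ac)
  have 5: "(L + 1) * c' = (N + 1) * c"
    using of_nat_Suc_binomial_Suc[of l n, where 'a=rat]
    by (simp add: c_def c'_def N_def L_def add_ac)
  \<comment> \<open>Multiplying by \<open>M + 2\<close>, \<open>L + 1\<close> and
    \<open>N + 1\<close> clears the denominators of the binomial ratios. What remains is \<open>(L +
    1) * (M + N + 3) + (M + 2) * (N - L) = (M + L + 3) * (N + 1)\<close>.\<close>
  have "(M + 2) * ((L + 1) * (N + 1) * ((M + L + 2) * (q' * b * c + q * b * c1)))
      = (L + 1) * (N + 1) * (M + L + 2) * b * ((M + N + 3) * q) * c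
        + (M + 2) * (N + 1) * (M + L + 2) * b * q * ((N - L) * c)"
    using 1 4 by algebra
  also have "\<dots> = (M + L + 3) * (N + 1) * (M + L + 2) * b * c * ((N + 1) * q)"
    by algebra
  also have "\<dots> = (M + 2) * ((M + L + 3) * q0 * ((M + L + 2) * b) * ((N + 1) * c))"
    unfolding 2 by (simp add: algebra_simps)
  also have "\<dots> = (M + 2) * ((L + 1) * (N + 1) * ((M + L + 3) * (q0 * b' * c')))"
    using 3 5 by algebra
  finally have "(M + L + 2) * (q' * b * c + q * b * c1) = (M + L + 3) * (q0 * b' * c')"
    using nz by (simp only: mult.assoc mult_cancel_left simp_thms)
  moreover have "of_nat (lin_num (Suc m) n l) = q' * b * c"
    by (simp add: lin_num_def q'_def b_def c_def add_ac numeral_3_eq_3)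
  moreover have "of_nat (lin_num m n (Suc l)) = q * b * c1"
    by (simp add: lin_num_def q_def b_def c1_def)
  ultimately have "(of_nat ((m + l + 2) * (lin_num (Suc m) n l + lin_num m n (Suc l))) :: rat)
    = of_nat ((m + l + 3) * (((m + n + 2) choose n) * ((m + l + 2) choose (n + 1)) * ((n + 1) choose (l + 1))))"
    by (simp only: of_nat_mult of_nat_add of_nat_numeral M_def L_def q0_def b'_def c'_def)
  then show ?thesis by (simp only: of_nat_eq_iff)
qed

lemma dvd_lin_num: "m + l + 2 dvd lin_num m n l"
proof (induction m arbitrary: l)
  case 0
  \<comment> \<open>The factors \<open>l choose n\<close> and \<open>n choose l\<close> are both
    nonzero only for \<open>l = n\<close>, where \<open>lin_num\<close> is
    \<open>n + 2\<close>.\<close>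
  show ?case
    by (cases l n rule: linorder_cases) (auto simp: lin_num_def binomial_eq_0)
next
  case (Suc m)
  have "m + l + 3 dvd (m + l + 2) * (lin_num (Suc m) n l + lin_num m n (Suc l))"
    unfolding lin_num_step by simp
  moreover have "coprime (m + l + 3) (m + l + 2)"
    using coprime_Suc_left_nat[of "m + l + 2"] by (simp add: numeral_3_eq_3)
  ultimately have "m + l + 3 dvd lin_num (Suc m) n l + lin_num m n (Suc l)"
    using coprime_dvd_mult_right_iff by blast
  \<comment> \<open>Lowering \<open>m\<close> while raising \<open>l\<close> keeps the divisor the
    same, hence the induction over arbitrary \<open>l\<close>.\<close>
  moreover have "m + l + 3 dvd lin_num m n (Suc l)"
    using Suc.IH[of "Suc l"] by (simp add: numeral_3_eq_3)
  ultimately have "m + l + 3 dvd lin_num (Suc m) n l"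
    using dvd_add_left_iff by blast
  then show ?case by (simp add: numeral_3_eq_3)
qed

lemma lin_coeff_in_Nats: "lin_coeff m n l \<in> \<nat>"
proof -
  obtain q where "lin_num m n l = (m + l + 2) * q"
    using dvd_lin_num by blast
  then have "lin_coeff m n l = of_nat q"
    unfolding lin_coeff_def by (simp only: of_nat_mult) (simp del: of_nat_add)
  then show ?thesis by simp
qed

text \<open>Obtained by multiplying the expansion for \<open>n\<close> by
  \<open>X - (n + 1) * (n + 2)\<close>, with \<open>X = (k + 1) * (k + 2)\<close>, and comparing
  coefficients at index \<open>m + l + 1\<close>. The next lemma is the lowest index, which receives
  nothing from below.\<close>

lemma lin_coeff_Suc:
  "of_nat ((n + 1) * (n + 2)) * lin_coeff m (Suc n) (Suc l)
    = of_nat ((m + l + 1) * (m + l + 2)) * lin_coeff m n l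
      + (of_nat ((m + l + 2) * (m + l + 3)) - of_nat ((n + 1) * (n + 2))) * lin_coeff m n (Suc l)"
proof -
  define M N L where "M = (of_nat m :: rat)" and "N = (of_nat n :: rat)" and "L = (of_nat l :: rat)"
  define q where "q = (of_nat ((m + n + 2) choose (n + 1)) :: rat)"
  define q' where "q' = (of_nat ((m + n + 3) choose (n + 2)) :: rat)"
  define b where "b = (of_nat ((m + l + 1) choose n) :: rat)"
  define b' where "b' = (of_nat ((m + l + 1) choose (n + 1)) :: rat)"
  define b0 where "b0 = (of_nat ((m + l) choose n) :: rat)"
  define c where "c = (of_nat (n choose l) :: rat)"
  define c1 where "c1 = (of_nat (n choose (l + 1)) :: rat)"
  have nz: "M + L + 2 \<noteq> 0" "M + L + 3 \<noteq> 0"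
    unfolding M_def L_def by linarith+
  have 1: "(N + 2) * q' = (M + N + 3) * q"
    using of_nat_Suc_binomial_Suc[of "n + 1" "m + n + 2", where 'a=rat]
    by (simp add: q_def q'_def M_def N_def add_ac numeral_3_eq_3)
  have 2: "(N + 1) * b' = (M + L + 1 - N) * b"
    using of_nat_binomial_Suc[of n "m + l + 1", where 'a=rat]
    by (simp add: b_def b'_def M_def N_def L_def add_ac)
  have 3: "(M + L + 1) * b0 = (M + L + 1 - N) * b"
    using of_nat_Suc_binomial[of "m + l" n, where 'a=rat]
    by (simp add: b_def b0_def M_def N_def L_def add_ac)
  have 4: "(L + 1) * c1 = (N - L) * c"
    using of_nat_binomial_Suc[of l n, where 'a=rat]
    by (simp add: c_def c1_def N_def L_def add_ac)
  have d1: "lin_coeff m (Suc n) (Suc l) = q' * b' * (c + c1) / (M + L + 3)"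
    by (simp add: lin_coeff_def lin_num_def q'_def b'_def c_def c1_def M_def L_def add_ac numeral_3_eq_3)
  have d2: "lin_coeff m n l = q * b0 * c / (M + L + 2)"
    by (simp add: lin_coeff_def lin_num_def q_def b0_def c_def M_def L_def add_ac)
  have d3: "lin_coeff m n (Suc l) = q * b * c1 / (M + L + 3)"
    by (simp add: lin_coeff_def lin_num_def q_def b_def c1_def M_def L_def add_ac)
  have "(N + 1) * (N + 2) * (q' * b' * (c + c1))
      = ((M + N + 3) * q) * ((M + L + 1 - N) * b) * (c + c1)"
    using 1 2 by algebra
  \<comment> \<open>The difference of products factors as
    \<open>(M + L + 1 - N) * (M + L + N + 4)\<close>. Once \<open>q * b * (M + L + 1 - N)\<close> is
    taken out, the identity reduces to fact 4.\<close>
  also have "\<dots> = (M + L + 3) * ((M + L + 1) * (q * b0 * c))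
      + ((M + L + 2) * (M + L + 3) - (N + 1) * (N + 2)) * (q * b * c1)"
    using 3 4 by algebra
  finally have "(N + 1) * (N + 2) * (q' * b' * (c + c1) / (M + L + 3))
      = (M + L + 1) * (M + L + 2) * (q * b0 * c / (M + L + 2))
      + ((M + L + 2) * (M + L + 3) - (N + 1) * (N + 2)) * (q * b * c1 / (M + L + 3))"
    using nz by (simp add: divide_simps)
  moreover have "of_nat ((n + 1) * (n + 2)) = (N + 1) * (N + 2)"
    "of_nat ((m + l + 1) * (m + l + 2)) = (M + L + 1) * (M + L + 2)"
    "of_nat ((m + l + 2) * (m + l + 3)) = (M + L + 2) * (M + L + 3)"
    by (simp_all add: M_def N_def L_def algebra_simps)
  ultimately show ?thesis unfolding d1 d2 d3 by (simp only:)
qed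

lemma lin_coeff_Suc_0:
  "of_nat ((n + 1) * (n + 2)) * lin_coeff m (Suc n) 0
    = (of_nat ((m + 1) * (m + 2)) - of_nat ((n + 1) * (n + 2))) * lin_coeff m n 0"
proof -
  define M N where "M = (of_nat m :: rat)" and "N = (of_nat n :: rat)"
  define q where "q = (of_nat ((m + n + 2) choose (n + 1)) :: rat)"
  define q' where "q' = (of_nat ((m + n + 3) choose (n + 2)) :: rat)"
  define b where "b = (of_nat (m choose n) :: rat)"
  define b' where "b' = (of_nat (m choose (n + 1)) :: rat)"
  have nz: "M + 2 \<noteq> 0"
    unfolding M_def by linarith
  have 1: "(N + 2) * q' = (M + N + 3) * q"
    using of_nat_Suc_binomial_Suc[of "n + 1" "m + n + 2", where 'a=rat]
    by (simp add: q_def q'_def M_def N_def add_ac numeral_3_eq_3)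
  have 2: "(N + 1) * b' = (M - N) * b"
    using of_nat_binomial_Suc[of n m, where 'a=rat]
    by (simp add: b_def b'_def M_def N_def add_ac)
  have d1: "lin_coeff m (Suc n) 0 = q' * b' / (M + 2)"
    by (simp add: lin_coeff_def lin_num_def q'_def b'_def M_def add_ac numeral_3_eq_3)
  have d2: "lin_coeff m n 0 = q * b / (M + 2)"
    by (simp add: lin_coeff_def lin_num_def q_def b_def M_def add_ac)
  have "(N + 1) * (N + 2) * (q' * b') = ((M + 1) * (M + 2) - (N + 1) * (N + 2)) * (q * b)"
    using 1 2 by algebra
  then have "(N + 1) * (N + 2) * (q' * b' / (M + 2))
      = ((M + 1) * (M + 2) - (N + 1) * (N + 2)) * (q * b / (M + 2))"
    by (simp only: times_divide_eq_right)
  moreover have "of_nat ((n + 1) * (n + 2)) = (N + 1) * (N + 2)"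
    "of_nat ((m + 1) * (m + 2)) = (M + 1) * (M + 2)"
    by (simp_all add: M_def N_def algebra_simps)
  ultimately show ?thesis unfolding d1 d2 by (simp only:)
qed

lemma w_mult_linearization:
  "w (Suc k) (Suc m) * w (Suc k) (Suc n) = (\<Sum>l\<le>n. lin_coeff m n l * w (Suc k) (Suc (m + l)))"
proof (induction n)
  case 0
  have "lin_coeff m 0 0 = 1"
    by (simp add: lin_coeff_def lin_num_def del: of_nat_Suc)
  then show ?case by (simp add: w_Suc_Suc)
next
  case (Suc n)
  define v where "v = (\<lambda>j. w (Suc k) (Suc j))"
  define X where "X = (of_nat ((k + 1) * (k + 2)) :: rat)"
  define a where "a = (\<lambda>j::nat. of_nat ((j + 1) * (j + 2)) :: rat)"
  define f where "f = (\<lambda>l. a (m + l) * lin_coeff m n l * v (m + Suc l))"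
  define g where "g = (\<lambda>l. (a (m + l) - a n) * lin_coeff m n l * v (m + l))"
  have rec: "a j * (v (Suc j) + v j) = X * v j" for j
    unfolding v_def a_def X_def by (rule w_recurrence)
  \<comment> \<open>The recurrence at \<open>n\<close> trades \<open>a n * v (Suc n)\<close> for
    \<open>(X - a n) * v n\<close>. Applied again at \<open>m + l\<close>, it splits each term into
    \<open>f l\<close>, which moves up one index, and \<open>g l\<close>, which stays.\<close>
  have "a n * (v m * v (Suc n)) = (X - a n) * (v m * v n)"
    using rec[of n] by algebra
  also have "\<dots> = (\<Sum>l\<le>n. lin_coeff m n l * ((X - a n) * v (m + l)))"
    using Suc.IH by (simp add: v_def sum_distrib_left mult_ac)
  also have "\<dots> = (\<Sum>l\<le>n. f l + g l)"
  proof (rule sum.cong)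
    fix l
    show "lin_coeff m n l * ((X - a n) * v (m + l)) = f l + g l"
      using rec[of "m + l"] unfolding f_def g_def by (simp only: add_Suc_right) algebra
  qed simp
  \<comment> \<open>\<open>g (Suc n)\<close> is zero because \<open>n choose Suc n\<close> is. After
    the shift, \<open>f l\<close> and \<open>g (Suc l)\<close> both carry
    \<open>v (m + Suc l)\<close>.\<close>
  also have "\<dots> = (\<Sum>l\<le>n. f l) + (\<Sum>l\<le>Suc n. g l)"
    by (simp add: sum.distrib g_def lin_coeff_def lin_num_def)
  also have "\<dots> = g 0 + (\<Sum>l\<le>n. f l + g (Suc l))"
    by (simp add: sum.atMost_Suc_shift sum.distrib del: sum.atMost_Suc)
  also have "g 0 = a n * (lin_coeff m (Suc n) 0 * v (m + 0))"
    using lin_coeff_Suc_0[of n m] by (simp add: g_def a_def mult.assoc[symmetric])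
  also have "(\<Sum>l\<le>n. f l + g (Suc l)) = (\<Sum>l\<le>n. a n * (lin_coeff m (Suc n) (Suc l) * v (m + Suc l)))"
  proof (rule sum.cong)
    fix l
    have a: "a (m + Suc l) = of_nat ((m + l + 2) * (m + l + 3))"
      unfolding a_def by (rule arg_cong[where f = of_nat]) (simp add: algebra_simps)
    have "a n * lin_coeff m (Suc n) (Suc l)
        = a (m + l) * lin_coeff m n l + (a (m + Suc l) - a n) * lin_coeff m n (Suc l)"
      unfolding a using lin_coeff_Suc[of n m l] unfolding a_def .
    then show "f l + g (Suc l) = a n * (lin_coeff m (Suc n) (Suc l) * v (m + Suc l))"
      unfolding f_def g_def by algebra
  qed simp
  also have "a n * (lin_coeff m (Suc n) 0 * v (m + 0)) + \<dots>
      = a n * (\<Sum>l\<le>Suc n. lin_coeff m (Suc n) l * v (m + l))"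
    by (simp add: sum.atMost_Suc_shift sum_distrib_left distrib_left del: sum.atMost_Suc)
  finally have "a n * (v m * v (Suc n)) = a n * (\<Sum>l\<le>Suc n. lin_coeff m (Suc n) l * v (m + l))" .
  moreover have "a n \<noteq> 0" unfolding a_def of_nat_eq_0_iff by simp
  ultimately show ?case unfolding v_def by (simp only: mult_cancel_left simp_thms)
qed

section \<open>Natural combinations of the \<open>w\<close>, closed under products\<close>

text \<open>
  The argument is shifted to \<open>Suc k\<close> because the recurrence for \<open>w\<close> fails at \<open>0\<close>, where \<open>k - 1\<close>
  is truncated.
\<close>

inductive nat_span :: "(nat \<Rightarrow> rat) \<Rightarrow> bool" where
  zero: "nat_span (\<lambda>k. 0)"
| base: "nat_span (\<lambda>k. w (Suc k) (Suc j))"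
| add: "nat_span f \<Longrightarrow> nat_span g \<Longrightarrow> nat_span (\<lambda>k. f k + g k)"

lemma nat_span_sum:
  "(\<And>i. i \<in> I \<Longrightarrow> nat_span (f i)) \<Longrightarrow> nat_span (\<lambda>k. \<Sum>i\<in>I. f i k)"
  by (induction I rule: infinite_finite_induct) (auto intro: nat_span.intros)

lemma nat_span_scale:
  assumes "nat_span f" "c \<in> \<nat>"
  shows "nat_span (\<lambda>k. c * f k)"
proof -
  obtain n where "c = of_nat n" using assms(2) by (rule Nats_cases)
  moreover have "nat_span (\<lambda>k. of_nat n * f k)"
    by (induction n) (auto simp: distrib_right intro: nat_span.intros assms(1))
  ultimately show ?thesis by simp
qed

text \<open>By bilinearity only products of two generators matter, and their linearization has
  natural coefficients.\<close>

lemma nat_span_mult: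
  assumes "nat_span f" "nat_span g"
  shows "nat_span (\<lambda>k. f k * g k)"
  using assms(1)
proof induction
  case (base i)
  show ?case using assms(2)
  proof induction
    case (base j)
    show ?case unfolding w_mult_linearization
      by (intro nat_span_sum nat_span_scale nat_span.base lin_coeff_in_Nats)
  qed (auto simp: distrib_left intro: nat_span.intros)
qed (auto simp: distrib_right intro: nat_span.intros)

lemma nat_span_1: "nat_span (\<lambda>k. 1)"
  using nat_span.base[of 0] by (simp add: w_Suc_Suc)

lemma nat_span_power: "nat_span f \<Longrightarrow> nat_span (\<lambda>k. f k ^ n)"
  by (induction n) (auto intro: nat_span_1 nat_span_mult)

lemma nat_span_X: "nat_span (\<lambda>k. of_nat ((k + 1) * (k + 2)))"
proof -
  \<comment> \<open>The recurrence at \<open>j = 0\<close>, where \<open>w (Suc k) (Suc 0)\<close>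
    is 1.\<close>
  have "of_nat ((k + 1) * (k + 2)) = 2 * (w (Suc k) (Suc 1) + w (Suc k) (Suc 0))" for k
    using w_recurrence[of 0 k] by (simp add: w_Suc_Suc[of k 0])
  then show ?thesis
    by (simp only: nat_span_scale nat_span.intros Nats_numeral)
qed

section \<open>Coefficients of powers of \<open>w_poly\<close>\<close>

lemma coeff_w_poly_Suc:
  assumes "\<alpha> > 0"
  shows "coeff (w_poly \<alpha> (Suc k)) i = w (Suc k) (Suc i) ^ \<alpha>"
proof -
  have "coeff (w_poly \<alpha> (Suc k)) i
      = (\<Sum>j = 1..Suc k. if j = Suc i then w (Suc k) (Suc i) ^ \<alpha> else 0)"
    unfolding w_poly_def coeff_sum by (rule sum.cong) auto
  also have "\<dots> = (if i \<le> k then w (Suc k) (Suc i) ^ \<alpha> else 0)"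
    by simp
  \<comment> \<open>For \<open>i > k\<close> the value \<open>w (Suc k) (Suc i)\<close> is 0, and so
    is its power since \<alpha> is positive; thus one formula covers every \<open>i\<close>.\<close>
  also have "\<dots> = w (Suc k) (Suc i) ^ \<alpha>"
    using assms by (simp add: w_Suc_Suc)
  finally show ?thesis .
qed

lemma nat_span_coeff_w_poly_power:
  assumes "\<alpha> > 0"
  shows "nat_span (\<lambda>k. coeff (w_poly \<alpha> (Suc k) ^ m) i)"
proof (induction m arbitrary: i)
  case 0
  then show ?case by (cases i) (auto intro: nat_span_1 nat_span.zero)
next
  case (Suc m)
  then show ?case
    by (simp add: coeff_mult coeff_w_poly_Suc[OF assms])
      (intro nat_span_sum nat_span_mult nat_span_power nat_span.base)
qed


section \<open>Telescoping sums\<close>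

text \<open>With \<open>t\<close> the summand at \<open>k = n\<close>, the same product
  \<open>P\<close> telescopes both sums: the multiplier \<open>(n + 1) * (j + 1)\<close> serves the
  plain sum, and \<open>(j + 1) * (j + 2)\<close> the alternating one.\<close>

lemma sum_w_step:
  fixes n j :: nat
  defines "P \<equiv> \<lambda>n. of_nat (n choose (j + 1)) * (of_nat ((n + j + 2) choose (j + 2)) :: rat)"
  defines "t \<equiv> of_nat (2 * n + 3) * (of_nat ((n + 1) * (n + 2)) * w (Suc n) (Suc j))"
  shows "of_nat ((n + 2) * (j + 1)) * P (Suc n) = of_nat ((n + 1) * (j + 1)) * P n + t"
    and "of_nat ((j + 1) * (j + 2)) * P (Suc n) = t - of_nat ((j + 1) * (j + 2)) * P n"
proof -
  define N J where "N = (of_nat n :: rat)" and "J = (of_nat j :: rat)"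
  define a where "a = (of_nat (n choose j) :: rat)"
  define a1 where "a1 = (of_nat (n choose (j + 1)) :: rat)"
  define b where "b = (of_nat ((n + j + 2) choose j) :: rat)"
  define b1 where "b1 = (of_nat ((n + j + 2) choose (j + 1)) :: rat)"
  define b2 where "b2 = (of_nat ((n + j + 2) choose (j + 2)) :: rat)"
  have nz: "J + 1 \<noteq> 0" "J + 2 \<noteq> 0" "N + 1 \<noteq> 0" "N + 2 \<noteq> 0"
    unfolding N_def J_def by linarith+
  \<comment> \<open>All binomials become rational multiples of \<open>a\<close> and
    \<open>b\<close>, with Pascal's rule handling \<open>P (Suc n)\<close>. Both claims are then
    rational identities in \<open>N\<close> and \<open>J\<close>.\<close>
  have 1: "a1 = (N - J) * a / (J + 1)"
    using of_nat_binomial_Suc[of j n, where 'a=rat] nz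
    by (simp add: a_def a1_def N_def J_def field_simps)
  have 2: "b1 = (N + 2) * b / (J + 1)"
    using of_nat_binomial_Suc[of j "n + j + 2", where 'a=rat] nz
    by (simp add: b_def b1_def N_def J_def field_simps)
  have "(J + 2) * b2 = (N + 1) * b1"
    using of_nat_binomial_Suc[of "j + 1" "n + j + 2", where 'a=rat]
    by (simp add: b1_def b2_def N_def J_def add_ac)
  then have 3: "b2 = (N + 1) * ((N + 2) * b / (J + 1)) / (J + 2)"
    using nz unfolding 2[symmetric] by (simp add: eq_divide_eq mult.commute)
  have w: "w (Suc n) (Suc j) = a * b / (J + 1)"
    by (simp add: w_Suc_Suc a_def b_def J_def add_ac)
  have P: "P n = a1 * b2"
    by (simp add: P_def a1_def b2_def)
  have P': "P (Suc n) = (a + a1) * (b1 + b2)"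
    by (simp add: P_def a_def a1_def b1_def b2_def)
  have t: "t = (2 * N + 3) * ((N + 1) * (N + 2) * (a * b / (J + 1)))"
    unfolding t_def w by (simp add: N_def algebra_simps)
  have coe: "of_nat ((n + 2) * (j + 1)) = (N + 2) * (J + 1)"
    "of_nat ((n + 1) * (j + 1)) = (N + 1) * (J + 1)"
    "of_nat ((j + 1) * (j + 2)) = (J + 1) * (J + 2)"
    by (simp_all add: N_def J_def algebra_simps)
  show "of_nat ((n + 2) * (j + 1)) * P (Suc n) = of_nat ((n + 1) * (j + 1)) * P n + t"
    unfolding P P' t coe 1 2 3 using nz by (simp add: divide_simps) algebra
  show "of_nat ((j + 1) * (j + 2)) * P (Suc n) = t - of_nat ((j + 1) * (j + 2)) * P n"
    unfolding P P' t coe 1 2 3 using nz by (simp add: divide_simps) algebra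
qed

lemma sum_w:
  "(\<Sum>k<n. of_nat (2 * k + 3) * (of_nat ((k + 1) * (k + 2)) * w (Suc k) (Suc j)))
    = of_nat ((n + 1) * (j + 1) * ((n choose (j + 1)) * ((n + j + 2) choose (j + 2))))"
proof (induction n)
  case (Suc n)
  have "Suc n + 1 = n + 2" by simp
  then show ?case unfolding sum.lessThan_Suc Suc.IH using sum_w_step(1)[where n = n and j = j, symmetric]
    by (simp only: of_nat_mult mult.assoc)
qed simp

lemma alternating_sum_w:
  "(\<Sum>k<n. (- 1) ^ Suc k * (of_nat (2 * k + 3) * (of_nat ((k + 1) * (k + 2)) * w (Suc k) (Suc j))))
    = (- 1) ^ n * of_nat ((j + 1) * (j + 2) * ((n choose (j + 1)) * ((n + j + 2) choose (j + 2))))"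
proof (induction n)
  case (Suc n)
  have "of_nat ((j + 1) * (j + 2) * ((Suc n choose (j + 1)) * ((Suc n + j + 2) choose (j + 2))))
      = of_nat (2 * n + 3) * (of_nat ((n + 1) * (n + 2)) * w (Suc n) (Suc j))
        - of_nat ((j + 1) * (j + 2) * ((n choose (j + 1)) * ((n + j + 2) choose (j + 2))))"
    using sum_w_step(2)[where n = n and j = j] by (simp only: of_nat_mult mult.assoc)
  then show ?case unfolding sum.lessThan_Suc Suc.IH unfolding power_Suc
    by (simp only: right_diff_distrib mult_minus1 mult_minus_left minus_diff_eq add_uminus_conv_diff)
qed simp

section \<open>Divisibility of the closed forms\<close>

text \<open>This is where the factor \<open>gcd 2 n\<close> arises: \<open>n + 2\<close> divides
  both \<open>n * x\<close> and \<open>(n + 2) * x\<close>, hence their gcd, and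
  \<open>gcd n (n + 2) = gcd 2 n\<close>.\<close>

lemma dvd_gcd_2_mult:
  fixes n x y :: nat
  assumes "n * x = (n + 2) * y"
  shows "n + 2 dvd gcd 2 n * x"
proof -
  have "n + 2 dvd n * x" unfolding assms by (rule dvd_triv_left)
  then have "n + 2 dvd gcd (n * x) ((n + 2) * x)"
    by (rule gcd_greatest) (rule dvd_triv_left)
  also have "gcd (n * x) ((n + 2) * x) = gcd 2 n * x"
    unfolding mult.commute[of _ x] gcd_mult_distrib_nat[symmetric] gcd_add2 gcd.commute[of n 2] ..
  finally show ?thesis .
qed

text \<open>Absorption extracts \<open>n * (n + 1)\<close> from each closed form, leaving
  \<open>a * b2\<close> for the plain sum and \<open>a * b1\<close> for the alternating one. For
  either cofactor, \<open>n\<close> times it is a multiple of \<open>n + 2\<close>, so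
  \<open>dvd_gcd_2_mult\<close> applies.\<close>

lemma
  fixes n j :: nat
  defines "P \<equiv> (n choose (j + 1)) * ((n + j + 2) choose (j + 2))"
  assumes "n > 0"
  shows dvd_sum_w: "n * (n + 1) * (n + 2) dvd gcd 2 n * ((n + 1) * (j + 1) * P)"
    and dvd_alternating_sum_w: "n * (n + 1) * (n + 2) dvd gcd 2 n * ((j + 1) * (j + 2) * P)"
proof -
  define a where "a = (n - 1) choose j"
  define b b1 b2 where "b = (n + j + 2) choose j" and "b1 = (n + j + 2) choose (j + 1)"
    and "b2 = (n + j + 2) choose (j + 2)"
  define c c1 where "c = n choose (j + 1)" and "c1 = (n + 1) choose (j + 2)"
  have a: "(j + 1) * c = n * a"
    using Suc_times_binomial[of j "n - 1"] assms(2) by (simp add: a_def c_def)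
  have c1: "(j + 2) * c1 = (n + 1) * c"
    using Suc_times_binomial[of "j + 1" n] by (simp add: c_def c1_def)
  have b1: "(j + 1) * b1 = (n + 2) * b"
    using binomial_absorption[of j "n + j + 2"] binomial_absorb_comp[of "n + j + 2" j]
    by (simp add: b_def b1_def)
  have b2: "(j + 2) * b2 = (n + 1) * b1"
    using binomial_absorption[of "j + 1" "n + j + 2"] binomial_absorb_comp[of "n + j + 2" "j + 1"]
    by (simp add: b1_def b2_def)
  have P: "P = c * b2" by (simp add: P_def c_def b2_def)
  have "n * (a * b1) = (n + 2) * (c * b)"
  proof -
    have "n * (a * b1) = c * ((j + 1) * b1)"
      unfolding mult.assoc[symmetric] a[symmetric] by (simp only: mult_ac)
    then show ?thesis unfolding b1 by (simp only: mult_ac)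
  qed
  then have "n + 2 dvd gcd 2 n * (a * b1)" by (rule dvd_gcd_2_mult)
  then have "n * (n + 1) * (n + 2) dvd n * (n + 1) * (gcd 2 n * (a * b1))" by (rule mult_dvd_mono[OF dvd_refl])
  also have "\<dots> = gcd 2 n * ((n * a) * ((n + 1) * b1))" by (simp only: mult_ac)
  also have "\<dots> = gcd 2 n * ((j + 1) * (j + 2) * P)"
    unfolding a[symmetric] b2[symmetric] P by (simp only: mult_ac)
  finally show "n * (n + 1) * (n + 2) dvd gcd 2 n * ((j + 1) * (j + 2) * P)" .
  \<comment> \<open>The extra \<open>n + 1\<close> turns \<open>c\<close> into
    \<open>(j + 2) * c1\<close>; the \<open>j + 2\<close> converts \<open>b2\<close> into
    \<open>(n + 1) * b1\<close>, after which \<open>n + 1\<close> cancels.\<close>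
  have "(n + 1) * (n * (a * b2)) = (j + 1) * ((n + 1) * c) * b2"
    unfolding mult.assoc[of n a b2, symmetric] a[symmetric] by (simp only: mult_ac)
  also have "\<dots> = (j + 1) * ((j + 2) * b2) * c1"
    unfolding c1[symmetric] by (simp only: mult_ac)
  also have "\<dots> = (n + 1) * ((j + 1) * b1) * c1"
    unfolding b2 by (simp only: mult_ac)
  also have "\<dots> = (n + 1) * ((n + 2) * (c1 * b))"
    unfolding b1 by (simp only: mult_ac)
  finally have "n * (a * b2) = (n + 2) * (c1 * b)"
    by (simp only: mult_cancel1 add_is_0 one_neq_zero simp_thms)
  then have "n + 2 dvd gcd 2 n * (a * b2)" by (rule dvd_gcd_2_mult)
  then have "n * (n + 1) * (n + 2) dvd n * (n + 1) * (gcd 2 n * (a * b2))" by (rule mult_dvd_mono[OF dvd_refl])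
  also have "\<dots> = gcd 2 n * ((n + 1) * (n * a) * b2)" by (simp only: mult_ac)
  also have "\<dots> = gcd 2 n * ((n + 1) * (j + 1) * P)"
    unfolding a[symmetric] P by (simp only: mult_ac)
  finally show "n * (n + 1) * (n + 2) dvd gcd 2 n * ((n + 1) * (j + 1) * P)" .
qed

lemma of_nat_divide_in_Ints:
  assumes "d dvd g * x"
  shows "of_nat g / of_nat d * of_nat x \<in> (\<int> :: 'a::field_char_0 set)"
proof -
  obtain q where q: "g * x = d * q" using assms by blast
  have "of_nat g / of_nat d * of_nat x = (of_nat (g * x) / of_nat d :: 'a)" by simp
  \<comment> \<open>Division by zero yields 0, which covers \<open>d = 0\<close>.\<close>
  also have "\<dots> = (if d = 0 then 0 else of_nat q)" unfolding q by simp
  finally show ?thesis by (metis Ints_0 Ints_of_nat)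
qed

section \<open>Integrality of the weighted sums and of the polynomials\<close>

text \<open>Both expressions are additive in \<open>f\<close>, so it suffices to treat the
  generators, where the sums have closed forms.\<close>

lemma nat_span_sum_in_Ints:
  fixes n :: nat
  defines "C \<equiv> of_nat (gcd 2 n) / of_nat (n * (n + 1) * (n + 2))"
  assumes "nat_span f" "n > 0"
  shows "C * (\<Sum>k<n. of_nat (2 * k + 3) * (of_nat ((k + 1) * (k + 2)) * f k)) \<in> \<int>"
    and "C * (\<Sum>k<n. (- 1) ^ Suc k * (of_nat (2 * k + 3) * (of_nat ((k + 1) * (k + 2)) * f k))) \<in> \<int>"
proof -
  show "C * (\<Sum>k<n. of_nat (2 * k + 3) * (of_nat ((k + 1) * (k + 2)) * f k)) \<in> \<int>"
    using assms(2)
  proof induction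
    case (base j)
    show ?case unfolding sum_w C_def
      using assms(3) by (intro of_nat_divide_in_Ints dvd_sum_w)
  next
    case (add f g)
    then show ?case by (simp only: distrib_left sum.distrib Ints_add)
  qed simp
  show "C * (\<Sum>k<n. (- 1) ^ Suc k * (of_nat (2 * k + 3) * (of_nat ((k + 1) * (k + 2)) * f k))) \<in> \<int>"
    using assms(2)
  proof induction
    case (base j)
    show ?case unfolding alternating_sum_w C_def mult.left_commute[of _ "(- 1) ^ n"]
      using assms(3) by (intro Ints_mult of_nat_divide_in_Ints dvd_alternating_sum_w) simp_all
  next
    case (add f g)
    then show ?case by (simp only: distrib_left sum.distrib Ints_add)
  qed simp
qed

theorem theorem3:
  fixes \<alpha> m n r :: nat
  assumes "\<alpha> > 0" and "m > 0" and "n > 0" and "r > 0"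
  shows "smult (of_nat (gcd 2 n) / of_nat (n * (n + 1) * (n + 2)))
           (\<Sum>k = 1..n. smult (of_nat (k ^ r * (k + 1) ^ r * (2 * k + 1))) (w_poly \<alpha> k ^ m))
         \<in> int_polys
       \<and> smult (of_nat (gcd 2 n) / of_nat (n * (n + 1) * (n + 2)))
           (\<Sum>k = 1..n. smult ((- 1) ^ k * of_nat (k ^ r * (k + 1) ^ r * (2 * k + 1))) (w_poly \<alpha> k ^ m))
         \<in> int_polys"
proof -
  define C :: rat where "C = of_nat (gcd 2 n) / of_nat (n * (n + 1) * (n + 2))"
  \<comment> \<open>\<open>f i\<close> absorbs all but one of the \<open>r\<close> factors
    \<open>(k + 1) * (k + 2)\<close>; as \<open>r\<close> is positive, one is left for the
    telescoping weight.\<close>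
  define f where "f i k = of_nat ((k + 1) * (k + 2)) ^ (r - 1) * coeff (w_poly \<alpha> (Suc k) ^ m) i"
    for i k
  have span: "nat_span (f i)" for i
    unfolding f_def
    by (intro nat_span_mult nat_span_power nat_span_X nat_span_coeff_w_poly_power assms(1))
  have weight: "of_nat (Suc k ^ r * (Suc k + 1) ^ r * (2 * Suc k + 1)) * coeff (w_poly \<alpha> (Suc k) ^ m) i
      = of_nat (2 * k + 3) * (of_nat ((k + 1) * (k + 2)) * f i k)" for i k
  proof -
    have "Suc k ^ r * (Suc k + 1) ^ r * (2 * Suc k + 1)
        = (2 * k + 3) * (((k + 1) * (k + 2)) * ((k + 1) * (k + 2)) ^ (r - 1))"
    proof -
      obtain s where r: "r = Suc s" using assms(4) gr0_implies_Suc by blast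
      have "Suc k = k + 1" "k + 1 + 1 = k + 2" "2 * (k + 1) + 1 = 2 * k + 3" by simp_all
      then show ?thesis
        unfolding r diff_Suc_1 by (simp only: power_mult_distrib power_Suc mult_ac)
    qed
    then show ?thesis
      unfolding f_def by (simp only: of_nat_mult of_nat_power mult.assoc)
  qed
  have shift: "(\<Sum>k = 1..n. F k) = (\<Sum>k<n. F (Suc k))" for F :: "nat \<Rightarrow> rat"
    using sum.atLeast1_atMost_eq[of F n] by simp
  show ?thesis
    \<comment> \<open>Membership is checked coefficient by coefficient, with the summation index
      moved from \<open>1..n\<close> to \<open>k < n\<close>.\<close>
    unfolding int_polys_def mem_Collect_eq coeff_smult coeff_sum shift weight mult.assoc[of "(- 1) ^ _"]
    using nat_span_sum_in_Ints[OF span assms(3)] by blast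
qed

end
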